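(* Let $G$ and $H$ be finite nilpotent groups. Then $G$ and $H$ are isomorphic if and only if $G \simeq_p H$ (that is, $G$ and $H$ are $p$-locally equivalent) for every prime $p$.
   Context: Let $G$ be a finite group and $P,Q\le G$. A homomorphism $f\colon P\to Q$ is a $G$-subconjugation if there is $g\in G$ with $f(x)=gxg^{-1}$ for all $x\in P$. Let $p$ be a prime. Finite groups $G$ and $H$ are $p$-locally equivalent, written $G\simeq_p H$, if there is a group isomorphism $\alpha\colon S\to R$ between some Sylow $p$-subgroup $S$ of $G$ and some Sylow $p$-subgroup $R$ of $H$ such that for all subgroups $P,Q\le S$ and every homomorphism $f\colon P\to Q$: $f$ is a $G$-subconjugation if and only if $\alpha f\alpha^{-1}\colon \alpha(P)\to\alpha(Q)$ is an $H$-subconjugation. Sylow $p$-subgroups are trivial when $p$ does not divide the group order. A group $G$ is nilpotent if its lower central series $\gamma_1(G)=G$, $\gamma_{n+1}(G)=[\gamma_n(G),G]$ satisfies $\gamma_n(G)=\{1\}$ for some $n$. *)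

theory Defs
  imports "HOL-Algebra.Algebra"
begin

definition commutator_subgroup :: "('a, 'c) monoid_scheme \<Rightarrow> 'a set \<Rightarrow> 'a set \<Rightarrow> 'a set" where
  "commutator_subgroup G A B =
     generate G {x \<otimes>\<^bsub>G\<^esub> y \<otimes>\<^bsub>G\<^esub> inv\<^bsub>G\<^esub> x \<otimes>\<^bsub>G\<^esub> inv\<^bsub>G\<^esub> y | x y. x \<in> A \<and> y \<in> B}"

(* Indexed from 0: lower_central G n is the term gamma_(n+1)(G) of the series. *)
primrec lower_central :: "('a, 'c) monoid_scheme \<Rightarrow> nat \<Rightarrow> 'a set" where
  "lower_central G 0 = carrier G"
| "lower_central G (Suc n) = commutator_subgroup G (lower_central G n) (carrier G)"

locale nilpotent_group = group +
  assumes nilpotent: "\<exists>n. lower_central G n = {\<one>}"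

(* Intended for finite G and prime p. If p does not divide the order, then card S = 1. *)
definition sylow_subgroup :: "nat \<Rightarrow> ('a, 'c) monoid_scheme \<Rightarrow> 'a set \<Rightarrow> bool" where
  "sylow_subgroup p G S \<longleftrightarrow> subgroup S G \<and> card S = p ^ multiplicity p (order G)"

definition subconjugation ::
    "('a, 'c) monoid_scheme \<Rightarrow> 'a set \<Rightarrow> 'a set \<Rightarrow> ('a \<Rightarrow> 'a) \<Rightarrow> bool" where
  "subconjugation G P Q f \<longleftrightarrow>
     f \<in> hom (G\<lparr>carrier := P\<rparr>) (G\<lparr>carrier := Q\<rparr>) \<and>
     (\<exists>g\<in>carrier G. \<forall>x\<in>P. f x = g \<otimes>\<^bsub>G\<^esub> x \<otimes>\<^bsub>G\<^esub> inv\<^bsub>G\<^esub> g)"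

(* inv_into S \<alpha> is the inverse isomorphism from R to S. Values of f outside P, and of the
   conjugated map outside \<alpha> ` P, play no role. *)
definition p_locally_equivalent ::
    "nat \<Rightarrow> ('a, 'c) monoid_scheme \<Rightarrow> ('b, 'd) monoid_scheme \<Rightarrow> bool" where
  "p_locally_equivalent p G H \<longleftrightarrow>
     (\<exists>S R \<alpha>. sylow_subgroup p G S \<and> sylow_subgroup p H R \<and>
        \<alpha> \<in> iso (G\<lparr>carrier := S\<rparr>) (H\<lparr>carrier := R\<rparr>) \<and>
        (\<forall>P Q. subgroup P G \<and> P \<subseteq> S \<and> subgroup Q G \<and> Q \<subseteq> S \<longrightarrow>
          (\<forall>f \<in> hom (G\<lparr>carrier := P\<rparr>) (G\<lparr>carrier := Q\<rparr>).
             subconjugation G P Q f \<longleftrightarrow>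
             subconjugation H (\<alpha> ` P) (\<alpha> ` Q) (\<alpha> \<circ> f \<circ> inv_into S \<alpha>))))"

end

theory Submission
  imports Defs
begin

text \<open>In a finite nilpotent group every Sylow subgroup is normal, so the group is the direct product of
  its Sylow subgroups and is determined up to isomorphism by them. Of \<open>p\<close>-local equivalence only the
  isomorphism of Sylow \<open>p\<close>-subgroups is therefore needed.\<close>

section \<open>Normality of Sylow subgroups in finite nilpotent groups\<close>

text \<open>The order of the coset of \<open>x\<close> in the quotient divides both \<open>k\<close>
  and the index, hence is 1. An infinite index has \<open>card\<close> 0, which forces
  \<open>k = 1\<close>.\<close>

lemma (in normal) mem_of_pow_mem_of_coprime_index:
  fixes k :: nat
  assumes "x \<in> carrier G" "x [^] k \<in> H" "coprime k (card (rcosets H))"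
  shows "x \<in> H"
proof -
  interpret Q: group "G Mod H" by (rule factorgroup_is_group)
  have cos: "H #> x \<in> carrier (G Mod H)"
    using assms(1) by (auto simp: FactGroup_def RCOSETS_def)
  have "(H #> x) [^]\<^bsub>G Mod H\<^esub> k = \<one>\<^bsub>G Mod H\<^esub>"
    using assms(1,2) by (simp add: FactGroup_pow rcos_const one_FactGroup)
  then have "Q.ord (H #> x) dvd k"
    using Q.pow_eq_id[OF cos] by simp
  moreover have "Q.ord (H #> x) dvd card (rcosets H)"
    using Q.ord_dvd_group_order[OF cos] by (simp add: order_def FactGroup_def)
  ultimately have "Q.ord (H #> x) = 1"
    using assms(3) by (metis coprime_common_divisor_nat)
  then have "H #> x = H"
    using Q.ord_eq_1[OF cos] by (simp add: one_FactGroup)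
  then show ?thesis
    using coset_join1 assms(1) subgroup_axioms by blast
qed

lemma (in group) pow_conj:
  assumes "x \<in> carrier G" "y \<in> carrier G"
  shows "(x \<otimes> y \<otimes> inv x) [^] (n::nat) = x \<otimes> y [^] n \<otimes> inv x"
proof (induction n)
  case (Suc n)
  have "x \<otimes> y [^] n \<otimes> inv x \<otimes> (x \<otimes> y \<otimes> inv x)
      = x \<otimes> y [^] n \<otimes> (inv x \<otimes> x) \<otimes> y \<otimes> inv x"
    using assms by (simp only: m_assoc m_closed inv_closed nat_pow_closed)
  then show ?case
    using Suc assms by (simp add: m_assoc)
qed (use assms in simp)

text \<open>Membership in \<open>normalizer\<close> means that conjugation by \<open>x\<close> maps
  \<open>S\<close> onto itself. As conjugation is injective and \<open>S\<close> is finite, mapping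
  \<open>S\<close> into itself suffices.\<close>

lemma (in group) mem_normalizer_iff:
  assumes "finite (carrier G)" "S \<subseteq> carrier G" "x \<in> carrier G"
  shows "x \<in> normalizer G S \<longleftrightarrow> (\<forall>s\<in>S. x \<otimes> s \<otimes> inv x \<in> S)"
proof -
  have eq: "x <# S #> inv x = (\<lambda>s. x \<otimes> s \<otimes> inv x) ` S"
    by (auto simp: l_coset_def r_coset_def)
  have "inj_on (\<lambda>s. x \<otimes> s \<otimes> inv x) S"
    using assms by (auto intro!: inj_onI simp: subset_iff)
  moreover have "finite S"
    using assms finite_subset by blast
  ultimately have "(\<lambda>s. x \<otimes> s \<otimes> inv x) ` S = S \<longleftrightarrow> (\<lambda>s. x \<otimes> s \<otimes> inv x) ` S \<subseteq> S"
    using endo_inj_surj by blast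
  then show ?thesis
    using assms eq by (auto simp: normalizer_def stabilizer_def)
qed

text \<open>A factor \<open>p\<close> in \<open>m\<close> would raise the power of \<open>p\<close>
  dividing \<open>n\<close> above its multiplicity. It is applied with \<open>m\<close> the index of
  a Sylow subgroup in its normalizer.\<close>

lemma prime_power_multiplicity_coprime_cofactor:
  fixes n m p :: nat
  assumes p: "Factorial_Ring.prime p" and "0 < n" "m * p ^ multiplicity p n dvd n"
  shows "coprime (p ^ multiplicity p n) m"
proof -
  have "\<not> p dvd m"
  proof
    assume "p dvd m"
    then have "p ^ Suc (multiplicity p n) dvd n"
      using assms(3) by (metis dvd_trans mult_dvd_mono dvd_refl power_Suc)
    then show False
      using assms(1,2) by (metis Suc_n_not_le_n not_prime_unit power_dvd_iff_le_multiplicity less_numeral_extra(3))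
  qed
  then show ?thesis
    using p by (simp add: prime_imp_coprime)
qed

text \<open>Let \<open>N\<close> be the normalizer of \<open>S\<close>. If \<open>\<gamma>\<^sub>n\<^sub>+\<^sub>1 \<subseteq> N\<close> and \<open>x \<in> \<gamma>\<^sub>n\<close>, then \<open>x s x\<^sup>-\<^sup>1 = [x, s] s \<in> N\<close>
  for \<open>s \<in> S\<close>; being of \<open>p\<close>-power order, this conjugate lies in the normal Sylow subgroup \<open>S\<close> of \<open>N\<close>,
  so \<open>x \<in> N\<close>. Descending along the series gives \<open>N = G\<close>.\<close>
lemma (in nilpotent_group) sylow_subgroup_normal:
  assumes fin: "finite (carrier G)" and p: "Factorial_Ring.prime p" and syl: "sylow_subgroup p G S"
  shows "S \<lhd> G"
proof -
  let ?N = "normalizer G S"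
  let ?a = "multiplicity p (order G)"
  have S: "subgroup S G" and cardS: "card S = p ^ ?a"
    using syl by (auto simp: sylow_subgroup_def)
  have Ssub: "S \<subseteq> carrier G"
    using S by (rule subgroup.subset)
  have N: "subgroup ?N G"
    using Ssub by (rule normalizer_imp_subgroup)
  interpret SN: normal S "G\<lparr>carrier := ?N\<rparr>"
    by (rule subgroup_in_normalizer[OF S])
  have SsubN: "S \<subseteq> ?N"
    using SN.subset by simp
  \<comment> \<open>Lagrange is used twice, for \<open>S\<close> in \<open>?N\<close> and for
    \<open>?N\<close> in \<open>G\<close>: the index of \<open>S\<close> in \<open>?N\<close> times
    the full \<open>p\<close>-part of \<open>order G\<close> divides \<open>order G\<close>.\<close>
  have "card (rcosets\<^bsub>G\<lparr>carrier := ?N\<rparr>\<^esub> S) * p ^ ?a = card ?N"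
    using SN.lagrange[OF SN.subgroup_axioms] cardS by (simp add: order_def)
  moreover have "card ?N dvd order G"
    using lagrange[OF N] by (metis dvd_triv_right)
  ultimately have cop: "coprime (p ^ ?a) (card (rcosets\<^bsub>G\<lparr>carrier := ?N\<rparr>\<^esub> S))"
    using p fin by (intro prime_power_multiplicity_coprime_cofactor) (auto simp: order_gt_0_iff_finite)
  have pow_S: "s [^] (p ^ ?a) = \<one>" if "s \<in> S" for s
    using group.pow_order_eq_1[OF subgroup_imp_group[OF S], of s] that cardS
    by (simp add: order_def flip: nat_pow_consistent)
  have mem: "x \<in> ?N" if x: "x \<in> carrier G" and conj: "\<And>s. s \<in> S \<Longrightarrow> x \<otimes> s \<otimes> inv x \<in> ?N" for x
  proof -
    have "x \<otimes> s \<otimes> inv x \<in> S" if s: "s \<in> S" for s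
    proof (rule SN.mem_of_pow_mem_of_coprime_index[OF _ _ cop])
      show "x \<otimes> s \<otimes> inv x \<in> carrier (G\<lparr>carrier := ?N\<rparr>)"
        using conj s by simp
      have "(x \<otimes> s \<otimes> inv x) [^] (p ^ ?a) = \<one>"
        using x s Ssub by (auto simp: pow_conj pow_S)
      then show "(x \<otimes> s \<otimes> inv x) [^]\<^bsub>G\<lparr>carrier := ?N\<rparr>\<^esub> (p ^ ?a) \<in> S"
        using subgroup.one_closed[OF S] by (simp flip: nat_pow_consistent)
    qed
    then show ?thesis
      using mem_normalizer_iff[OF fin Ssub x] by blast
  qed
  have lc_sub: "lower_central G n \<subseteq> carrier G" for n
  proof (induction n)
    case (Suc n)
    then show ?case
      unfolding lower_central.simps commutator_subgroup_def by (intro generate_incl) auto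
  qed simp
  obtain c where c: "lower_central G c = {\<one>}"
    using nilpotent by blast
  \<comment> \<open>The induction climbs from the trivial term at \<open>c\<close> up to the whole
    group at index 0, reached for \<open>i = c\<close>. Beyond that the truncated subtraction only
    repeats index 0.\<close>
  have "lower_central G (c - i) \<subseteq> ?N" for i
  proof (induction i)
    case 0
    then show ?case
      using c subgroup.one_closed[OF N] by simp
  next
    case (Suc i)
    show ?case
    proof (cases "i < c")
      case True
      define n where "n = c - Suc i"
      have IH: "lower_central G (Suc n) \<subseteq> ?N"
        using Suc True by (simp add: n_def Suc_diff_Suc)
      show ?thesis
        unfolding n_def[symmetric]
      proof
        fix x assume x: "x \<in> lower_central G n"
        then have xG: "x \<in> carrier G"
          using lc_sub by blast
        show "x \<in> ?N"
        proof (rule mem[OF xG])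
          fix s assume s: "s \<in> S"
          then have sG: "s \<in> carrier G"
            using Ssub by blast
          have "x \<otimes> s \<otimes> inv x \<otimes> inv s \<in> lower_central G (Suc n)"
            using x sG by (auto simp: commutator_subgroup_def intro!: generate.incl)
          then have "x \<otimes> s \<otimes> inv x \<otimes> inv s \<otimes> s \<in> ?N"
            using IH s SsubN subgroup.m_closed[OF N] by blast
          then show "x \<otimes> s \<otimes> inv x \<in> ?N"
            using xG sG by (simp add: m_assoc)
        qed
      qed
    next
      case False
      then show ?thesis
        using Suc by simp
    qed
  qed
  from this[of c] have "carrier G \<subseteq> ?N"
    by simp
  then show ?thesis
    using S mem_normalizer_iff[OF fin Ssub] by (auto simp: normal_inv_iff)
qed

section \<open>Internal direct products of two normal subgroups\<close>

text \<open>By Lagrange inside \<open>A\<close> and inside \<open>B\<close>, the order of the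
  intersection divides two coprime numbers.\<close>

lemma (in group) coprime_card_subgroups_Int:
  assumes A: "subgroup A G" and B: "subgroup B G" and cop: "coprime (card A) (card B)"
  shows "A \<inter> B = {\<one>}"
proof -
  have I: "subgroup (A \<inter> B) G"
    using A B by (rule subgroups_Inter_pair)
  have "card (A \<inter> B) dvd card K" if "subgroup K G" "A \<inter> B \<subseteq> K" for K
    using group.lagrange[OF subgroup_imp_group[OF that(1)] subgroup_incl[OF I that]]
    by (simp add: order_def) (metis dvd_triv_right)
  then have "card (A \<inter> B) = 1"
    using A B cop by (metis coprime_common_divisor_nat inf_le1 inf_le2)
  then show ?thesis
    using subgroup.one_closed[OF I] by (metis card_1_singletonE singletonD)
qed

text \<open>Conjugating \<open>a \<otimes> b\<close> conjugates each factor separately. Normality is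
  what allows further Sylow subgroups to be multiplied on one at a time.\<close>

lemma (in group) normal_set_mult:
  assumes A: "A \<lhd> G" and B: "B \<lhd> G"
  shows "A <#> B \<lhd> G"
  unfolding normal_inv_iff
proof (intro conjI ballI)
  have sub: "A \<subseteq> carrier G" "B \<subseteq> carrier G"
    using A B by (simp_all add: normal_imp_subgroup subgroup.subset)
  show "subgroup (A <#> B) G"
    using A B by (intro second_isomorphism_grp.normal_set_mult_subgroup second_isomorphism_grp.intro
        second_isomorphism_grp_axioms.intro normal_imp_subgroup)
  fix x h assume x: "x \<in> carrier G" and "h \<in> A <#> B"
  then obtain a b where ab: "a \<in> A" "b \<in> B" "h = a \<otimes> b"
    by (auto simp: set_mult_def)
  have carr: "a \<in> carrier G" "b \<in> carrier G"
    using ab sub by auto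
  have "x \<otimes> h \<otimes> inv x = (x \<otimes> a \<otimes> inv x) \<otimes> (x \<otimes> b \<otimes> inv x)"
  proof -
    have "(x \<otimes> a \<otimes> inv x) \<otimes> (x \<otimes> b \<otimes> inv x) = x \<otimes> a \<otimes> (inv x \<otimes> x) \<otimes> b \<otimes> inv x"
      using x carr by (simp only: m_assoc m_closed inv_closed)
    then show ?thesis
      using x carr ab by (simp add: m_assoc)
  qed
  moreover have "x \<otimes> a \<otimes> inv x \<in> A" "x \<otimes> b \<otimes> inv x \<in> B"
    using A B ab x by (simp_all add: normal_inv_iff)
  ultimately show "x \<otimes> h \<otimes> inv x \<in> A <#> B"
    by (auto simp: set_mult_def)
qed

text \<open>Normal subgroups meeting trivially commute elementwise, so multiplication is a
  homomorphism on the external product. Trivial intersection also makes factorizations unique, which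
  is injectivity.\<close>

lemma (in group) DirProd_iso_normal_set_mult:
  assumes A: "A \<lhd> G" and B: "B \<lhd> G" and AB: "A \<inter> B = {\<one>}"
  shows "(\<lambda>(x, y). x \<otimes> y) \<in> iso (G\<lparr>carrier := A\<rparr> \<times>\<times> G\<lparr>carrier := B\<rparr>) (G\<lparr>carrier := A <#> B\<rparr>)"
proof -
  interpret group_disjoint_sum G A B
    using A B by (intro group_disjoint_sum.intro normal_imp_subgroup is_group)
  have comm: "x \<otimes> y = y \<otimes> x" if "x \<in> A" "y \<in> B" for x y
    using normal_imp_commuting[OF A B] AB that by blast
  have "x \<otimes> u \<otimes> (y \<otimes> v) = x \<otimes> y \<otimes> (u \<otimes> v)" if "x \<in> A" "u \<in> A" "y \<in> B" "v \<in> B" for x u y v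
  proof -
    have "x \<otimes> u \<otimes> (y \<otimes> v) = x \<otimes> (u \<otimes> y) \<otimes> v"
      using that by (simp add: m_assoc AG.mem_carrier BG.mem_carrier)
    also have "\<dots> = x \<otimes> y \<otimes> (u \<otimes> v)"
      using that comm[of u y] by (simp add: m_assoc AG.mem_carrier BG.mem_carrier)
    finally show ?thesis .
  qed
  moreover have "\<forall>x\<in>A. \<forall>y\<in>B. \<forall>x'\<in>A. \<forall>y'\<in>B. x \<otimes> y = x' \<otimes> y' \<longrightarrow> x = x' \<and> y = y'"
    using AB cancel by blast
  ultimately show ?thesis
    unfolding iso_iff by (auto simp: hom_def inj_on_def set_mult_def DirProd_def)
qed

lemma (in group) card_normal_set_mult:
  assumes "A \<lhd> G" "B \<lhd> G" "A \<inter> B = {\<one>}"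
  shows "card (A <#> B) = card A * card B"
  using iso_same_card[OF is_isoI[OF DirProd_iso_normal_set_mult[OF assms]]]
  by (simp add: card_cartesian_product)

text \<open>Both products are isomorphic to external direct products, on which the two given
  isomorphisms act componentwise.\<close>

lemma iso_normal_set_mult:
  assumes "group G" "group H" "A \<lhd> G" "B \<lhd> G" "A \<inter> B = {\<one>\<^bsub>G\<^esub>}"
    and "C \<lhd> H" "D \<lhd> H" "C \<inter> D = {\<one>\<^bsub>H\<^esub>}"
    and AC: "G\<lparr>carrier := A\<rparr> \<cong> H\<lparr>carrier := C\<rparr>" and BD: "G\<lparr>carrier := B\<rparr> \<cong> H\<lparr>carrier := D\<rparr>"
  shows "G\<lparr>carrier := A <#>\<^bsub>G\<^esub> B\<rparr> \<cong> H\<lparr>carrier := C <#>\<^bsub>H\<^esub> D\<rparr>"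
proof -
  interpret G: group G by fact
  interpret H: group H by fact
  have gA: "group (G\<lparr>carrier := A\<rparr>)" "group (G\<lparr>carrier := B\<rparr>)"
    using assms by (simp_all add: G.subgroup_imp_group normal_imp_subgroup)
  have "G\<lparr>carrier := A <#>\<^bsub>G\<^esub> B\<rparr> \<cong> G\<lparr>carrier := A\<rparr> \<times>\<times> G\<lparr>carrier := B\<rparr>"
    using group.iso_sym[OF DirProd_group[OF gA] is_isoI[OF G.DirProd_iso_normal_set_mult[OF assms(3-5)]]] .
  moreover have "G\<lparr>carrier := A\<rparr> \<times>\<times> G\<lparr>carrier := B\<rparr> \<cong> H\<lparr>carrier := C\<rparr> \<times>\<times> H\<lparr>carrier := D\<rparr>"
    using group.DirProd_iso_trans[OF gA(1) AC BD] .
  moreover have "H\<lparr>carrier := C\<rparr> \<times>\<times> H\<lparr>carrier := D\<rparr> \<cong> H\<lparr>carrier := C <#>\<^bsub>H\<^esub> D\<rparr>"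
    using is_isoI[OF H.DirProd_iso_normal_set_mult[OF assms(6-8)]] .
  ultimately show ?thesis
    by (rule iso_trans[OF iso_trans])
qed

section \<open>Reassembling a nilpotent group from its Sylow subgroups\<close>

text \<open>\<open>N\<close> and \<open>M\<close> are the Hall \<pi>-subgroups, built by induction
  on \<pi> by multiplying on the Sylow \<open>p\<close>-subgroup for each new prime
  \<open>p\<close>. Recording their orders lets them be identified with \<open>G\<close> and
  \<open>H\<close> once \<pi> is large enough.\<close>

lemma nilpotent_iso_Hall_subgroups:
  fixes G :: "('a, 'c) monoid_scheme" and H :: "('b, 'd) monoid_scheme" and \<pi> :: "nat set"
  assumes G: "nilpotent_group G" "finite (carrier G)" and H: "nilpotent_group H" "finite (carrier H)"
    and "finite \<pi>" "\<And>p. p \<in> \<pi> \<Longrightarrow> Factorial_Ring.prime p" "\<And>p. p \<in> \<pi> \<Longrightarrow> p_locally_equivalent p G H"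
  shows "\<exists>N M. N \<lhd> G \<and> M \<lhd> H \<and> card N = (\<Prod>p\<in>\<pi>. p ^ multiplicity p (order G)) \<and>
    card M = (\<Prod>p\<in>\<pi>. p ^ multiplicity p (order H)) \<and> G\<lparr>carrier := N\<rparr> \<cong> H\<lparr>carrier := M\<rparr>"
  using assms(5-7)
proof (induction \<pi> rule: finite_induct)
  case empty
  interpret G: nilpotent_group G by fact
  interpret H: nilpotent_group H by fact
  have "(\<lambda>_. \<one>\<^bsub>H\<^esub>) \<in> iso (G\<lparr>carrier := {\<one>\<^bsub>G\<^esub>}\<rparr>) (H\<lparr>carrier := {\<one>\<^bsub>H\<^esub>}\<rparr>)"
    by (auto simp: iso_iff hom_def)
  then show ?case
    using G.one_is_normal H.one_is_normal is_isoI by (intro exI conjI) auto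
next
  case (insert p \<pi>)
  interpret G: nilpotent_group G by fact
  interpret H: nilpotent_group H by fact
  obtain N M where N: "N \<lhd> G" "card N = (\<Prod>p\<in>\<pi>. p ^ multiplicity p (order G))"
    and M: "M \<lhd> H" "card M = (\<Prod>p\<in>\<pi>. p ^ multiplicity p (order H))"
    and NM: "G\<lparr>carrier := N\<rparr> \<cong> H\<lparr>carrier := M\<rparr>"
    using insert by auto
  have p: "Factorial_Ring.prime p"
    using insert by simp
  obtain S R where S: "sylow_subgroup p G S" and R: "sylow_subgroup p H R"
    and SR: "G\<lparr>carrier := S\<rparr> \<cong> H\<lparr>carrier := R\<rparr>"
    using insert.prems(2)[of p] is_isoI unfolding p_locally_equivalent_def by blast
  \<comment> \<open>Arbitrary exponents make this serve both groups, whose multiplicities are not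
    yet known to agree.\<close>
  have cop: "coprime (\<Prod>q\<in>\<pi>. q ^ f q) (p ^ k)" for f :: "nat \<Rightarrow> nat" and k
  proof (intro prod_coprime_left)
    fix q assume "q \<in> \<pi>"
    then have "coprime q p"
      using insert by (intro primes_coprime) auto
    then show "coprime (q ^ f q) (p ^ k)"
      by simp
  qed
  have Sn: "S \<lhd> G" and Rn: "R \<lhd> H"
    using G.sylow_subgroup_normal[OF G(2) p S] H.sylow_subgroup_normal[OF H(2) p R] by auto
  have cards: "card S = p ^ multiplicity p (order G)" "card R = p ^ multiplicity p (order H)"
    using S R by (simp_all add: sylow_subgroup_def)
  have Int: "N \<inter> S = {\<one>\<^bsub>G\<^esub>}" "M \<inter> R = {\<one>\<^bsub>H\<^esub>}"
    using N M Sn Rn cards cop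
    by (simp_all only: G.coprime_card_subgroups_Int H.coprime_card_subgroups_Int normal_imp_subgroup)
  show ?case
  proof (intro exI conjI)
    show "N <#>\<^bsub>G\<^esub> S \<lhd> G" "M <#>\<^bsub>H\<^esub> R \<lhd> H"
      using N M Sn Rn by (simp_all add: G.normal_set_mult H.normal_set_mult)
    show "card (N <#>\<^bsub>G\<^esub> S) = (\<Prod>p\<in>insert p \<pi>. p ^ multiplicity p (order G))"
      using G.card_normal_set_mult[OF N(1) Sn Int(1)] N(2) cards insert.hyps by simp
    show "card (M <#>\<^bsub>H\<^esub> R) = (\<Prod>p\<in>insert p \<pi>. p ^ multiplicity p (order H))"
      using H.card_normal_set_mult[OF M(1) Rn Int(2)] M(2) cards insert.hyps by simp
    show "G\<lparr>carrier := N <#>\<^bsub>G\<^esub> S\<rparr> \<cong> H\<lparr>carrier := M <#>\<^bsub>H\<^esub> R\<rparr>"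
      using iso_normal_set_mult[OF G.is_group H.is_group N(1) Sn Int(1) M(1) Rn Int(2) NM SR] .
  qed
qed

lemma nilpotent_iso_of_p_locally_equivalent:
  fixes G :: "('a, 'c) monoid_scheme" and H :: "('b, 'd) monoid_scheme"
  assumes G: "nilpotent_group G" "finite (carrier G)" and H: "nilpotent_group H" "finite (carrier H)"
    and "\<And>p::nat. Factorial_Ring.prime p \<Longrightarrow> p_locally_equivalent p G H"
  shows "G \<cong> H"
proof -
  interpret G: nilpotent_group G by fact
  interpret H: nilpotent_group H by fact
  \<comment> \<open>The union is taken because equality of the two orders is not known in
    advance.\<close>
  define \<pi> where "\<pi> = prime_factors (order G) \<union> prime_factors (order H)"
  have pos: "0 < order G" "0 < order H"
    using G H by (simp_all add: G.order_gt_0_iff_finite H.order_gt_0_iff_finite)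
  have fin: "finite \<pi>" and pr: "\<And>p. p \<in> \<pi> \<Longrightarrow> Factorial_Ring.prime p"
    by (auto simp: \<pi>_def)
  have prod: "(\<Prod>p\<in>\<pi>. p ^ multiplicity p n) = n" if "0 < n" "prime_factors n \<subseteq> \<pi>" for n
  proof -
    \<comment> \<open>Primes of \<pi> that do not divide \<open>n\<close> have multiplicity 0 and
      contribute a factor 1.\<close>
    have "(\<Prod>p\<in>\<pi>. p ^ multiplicity p n) = (\<Prod>p\<in>prime_factors n. p ^ multiplicity p n)"
      using that fin pr
      by (intro prod.mono_neutral_right) (auto simp: prime_factors_multiplicity)
    then show ?thesis
      using that prime_factorization_nat[of n] by simp
  qed
  obtain N M where "N \<lhd> G" "M \<lhd> H" and cards: "card N = order G" "card M = order H"
    and NM: "G\<lparr>carrier := N\<rparr> \<cong> H\<lparr>carrier := M\<rparr>"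
    using nilpotent_iso_Hall_subgroups[OF G H fin pr assms(5)[OF pr]]
      prod[OF pos(1)] prod[OF pos(2)] \<pi>_def by auto
  then have "N = carrier G" "M = carrier H"
    using G H by (simp_all add: card_subset_eq normal_imp_subgroup subgroup.subset order_def)
  then show ?thesis
    using NM by simp
qed

section \<open>Local equivalence of isomorphic groups\<close>

text \<open>Sylow's theorem gives a subgroup of order \<open>p ^ a\<close> whenever
  \<open>order G = p ^ a * m\<close>; here \<open>a\<close> is chosen as the full
  multiplicity.\<close>

lemma (in group) sylow_subgroup_exists:
  assumes "finite (carrier G)" "Factorial_Ring.prime p"
  shows "\<exists>S. sylow_subgroup p G S"
proof -
  obtain m where "order G = p ^ multiplicity p (order G) * m"
    using multiplicity_dvd by (metis dvdE)
  from sylow_thm[OF assms(2) is_group this assms(1)] show ?thesis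
    by (simp add: sylow_subgroup_def)
qed

text \<open>An isomorphism \<open>\<phi>\<close> restricts to any Sylow subgroup \<open>S\<close>
  and turns conjugation by \<open>g\<close> into conjugation by \<open>\<phi> g\<close>. Injectivity
  reflects the conjugation equations back to \<open>G\<close>, and surjectivity provides a preimage
  for every conjugating element of \<open>H\<close>.\<close>

lemma p_locally_equivalent_of_iso:
  fixes G :: "('a, 'c) monoid_scheme" and H :: "('b, 'd) monoid_scheme"
  assumes G: "group G" and H: "group H" and fin: "finite (carrier G)"
    and p: "Factorial_Ring.prime p" and "G \<cong> H"
  shows "p_locally_equivalent p G H"
proof -
  interpret G: group G by fact
  interpret H: group H by fact
  obtain \<phi> where \<phi>: "\<phi> \<in> iso G H"
    using assms(5) by (auto simp: is_iso_def)
  interpret \<phi>: group_hom G H \<phi>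
    using \<phi> by unfold_locales (simp add: iso_def)
  have inj: "inj_on \<phi> (carrier G)" and surj: "\<phi> ` carrier G = carrier H"
    using \<phi> by (auto simp: iso_iff)
  obtain S where S: "sylow_subgroup p G S"
    using G.sylow_subgroup_exists[OF fin p] by blast
  then have sub: "subgroup S G"
    by (simp add: sylow_subgroup_def)
  have SG: "S \<subseteq> carrier G"
    using sub by (rule subgroup.subset)
  have injS: "inj_on \<phi> S"
    using inj SG by (rule inj_on_subset)
  have "order G = order H"
    using iso_same_card[OF assms(5)] by (simp add: order_def)
  then have R: "sylow_subgroup p H (\<phi> ` S)"
    using S injS by (simp add: sylow_subgroup_def card_image \<phi>.subgroup_img_is_subgroup)
  have iso: "\<phi> \<in> iso (G\<lparr>carrier := S\<rparr>) (H\<lparr>carrier := \<phi> ` S\<rparr>)"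
    using injS SG by (auto simp: iso_iff hom_def subset_iff)
  have "subconjugation G P Q f \<longleftrightarrow>
      subconjugation H (\<phi> ` P) (\<phi> ` Q) (\<phi> \<circ> f \<circ> inv_into S \<phi>)"
    if P: "subgroup P G" "P \<subseteq> S" and Q: "subgroup Q G" "Q \<subseteq> S"
      and f: "f \<in> hom (G\<lparr>carrier := P\<rparr>) (G\<lparr>carrier := Q\<rparr>)" for P Q f
  proof -
    have fPQ: "f x \<in> Q" if "x \<in> P" for x
      using f that by (auto simp: hom_def)
    have PG: "x \<in> carrier G" if "x \<in> P" for x
      using that P SG by blast
    have QG: "x \<in> carrier G" if "x \<in> Q" for x
      using that Q SG by blast
    \<comment> \<open>This is the only fact about \<open>inv_into\<close> required below, so
      \<open>comp_apply\<close> is removed from the simpset to keep the composite folded.\<close>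
    have val: "(\<phi> \<circ> f \<circ> inv_into S \<phi>) (\<phi> x) = \<phi> (f x)" if "x \<in> P" for x
      using that P injS by (auto simp: subset_iff)
    have Pm: "x \<otimes>\<^bsub>G\<^esub> y \<in> P" if "x \<in> P" "y \<in> P" for x y
      using subgroup.m_closed[OF P(1)] that .
    have hom: "\<phi> \<circ> f \<circ> inv_into S \<phi> \<in> hom (H\<lparr>carrier := \<phi> ` P\<rparr>) (H\<lparr>carrier := \<phi> ` Q\<rparr>)"
    proof (rule homI)
      fix u v assume "u \<in> carrier (H\<lparr>carrier := \<phi> ` P\<rparr>)" "v \<in> carrier (H\<lparr>carrier := \<phi> ` P\<rparr>)"
      then obtain x y where xy: "x \<in> P" "y \<in> P" "u = \<phi> x" "v = \<phi> y"
        by auto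
      have "u \<otimes>\<^bsub>H\<^esub> v = \<phi> (x \<otimes>\<^bsub>G\<^esub> y)"
        using xy PG by simp
      moreover have "f (x \<otimes>\<^bsub>G\<^esub> y) = f x \<otimes>\<^bsub>G\<^esub> f y"
        using f xy by (auto simp: hom_def)
      ultimately show "(\<phi> \<circ> f \<circ> inv_into S \<phi>) (u \<otimes>\<^bsub>H\<lparr>carrier := \<phi> ` P\<rparr>\<^esub> v) =
          (\<phi> \<circ> f \<circ> inv_into S \<phi>) u \<otimes>\<^bsub>H\<lparr>carrier := \<phi> ` Q\<rparr>\<^esub> (\<phi> \<circ> f \<circ> inv_into S \<phi>) v"
        using xy by (simp del: comp_apply add: val Pm fPQ QG)
    qed (use val fPQ in force)
    have "f x = g \<otimes>\<^bsub>G\<^esub> x \<otimes>\<^bsub>G\<^esub> inv\<^bsub>G\<^esub> g \<longleftrightarrow>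
        (\<phi> \<circ> f \<circ> inv_into S \<phi>) (\<phi> x) = \<phi> g \<otimes>\<^bsub>H\<^esub> \<phi> x \<otimes>\<^bsub>H\<^esub> inv\<^bsub>H\<^esub> (\<phi> g)"
      if g: "g \<in> carrier G" and x: "x \<in> P" for g x
    proof -
      have "\<phi> g \<otimes>\<^bsub>H\<^esub> \<phi> x \<otimes>\<^bsub>H\<^esub> inv\<^bsub>H\<^esub> (\<phi> g) = \<phi> (g \<otimes>\<^bsub>G\<^esub> x \<otimes>\<^bsub>G\<^esub> inv\<^bsub>G\<^esub> g)"
        using g x PG by simp
      then show ?thesis
        using inj_on_eq_iff[OF inj, of "f x" "g \<otimes>\<^bsub>G\<^esub> x \<otimes>\<^bsub>G\<^esub> inv\<^bsub>G\<^esub> g"] val[OF x] g x PG QG fPQ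
        by simp
    qed
    \<comment> \<open>Here \<open>h\<close> ranges over the image of \<open>carrier G\<close>, which
      \<open>surj\<close> then identifies with \<open>carrier H\<close>.\<close>
    then have "(\<exists>g\<in>carrier G. \<forall>x\<in>P. f x = g \<otimes>\<^bsub>G\<^esub> x \<otimes>\<^bsub>G\<^esub> inv\<^bsub>G\<^esub> g) \<longleftrightarrow>
        (\<exists>h\<in>\<phi> ` carrier G. \<forall>y\<in>\<phi> ` P. (\<phi> \<circ> f \<circ> inv_into S \<phi>) y = h \<otimes>\<^bsub>H\<^esub> y \<otimes>\<^bsub>H\<^esub> inv\<^bsub>H\<^esub> h)"
      by (simp del: comp_apply)
    then show ?thesis
      unfolding subconjugation_def using f hom surj by simp
  qed
  then show ?thesis
    unfolding p_locally_equivalent_def using S R iso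
    by (intro exI[of _ S] exI[of _ "\<phi> ` S"] exI[of _ \<phi>]) (simp del: comp_apply)
qed

theorem mainTheorem1:
  fixes G :: "('a, 'c) monoid_scheme" and H :: "('b, 'd) monoid_scheme"
  assumes "nilpotent_group G" and "finite (carrier G)"
    and "nilpotent_group H" and "finite (carrier H)"
  shows "G \<cong> H \<longleftrightarrow> (\<forall>p::nat. Factorial_Ring.prime p \<longrightarrow> p_locally_equivalent p G H)"
proof
  assume "G \<cong> H"
  then show "\<forall>p::nat. Factorial_Ring.prime p \<longrightarrow> p_locally_equivalent p G H"
    using p_locally_equivalent_of_iso[of G H] assms nilpotent_group.axioms(1)[of G]
      nilpotent_group.axioms(1)[of H] by simp
next
  assume "\<forall>p::nat. Factorial_Ring.prime p \<longrightarrow> p_locally_equivalent p G H"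
  then show "G \<cong> H"
    using nilpotent_iso_of_p_locally_equivalent[OF assms] by blast
qed

end
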